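(* Let $a\in\mathbb{Z}_{\ge1}^n$ be harmonic capacities (i.e. $a_i\ge a_j$ implies $a_i/a_j\in\mathbb{Z}$), let $\beta$ be an integer with $\beta\ge a_{\max}=\max_ia_i$, and let $w\in\mathbb{Z}_{\ge0}^n$ with $\sum_{i\le n}w_i/a_i\le1$. Then \[ \min\Big\{s+\sum_{i\le n}w_ix_i : s+a_ix_i\ge\beta\ \forall i\le n,\ s\in\mathbb{Z}_{\ge0},\ x\in\mathbb{Z}^n\Big\} \] can be computed using $O(n\log n+n\log\beta)\le O(n\log(n+\beta))$ arithmetic operations.
   Context: Running times count arithmetic operations on numbers from the input. *)

theory Defs
  imports Complex_Main "HOL-Library.Landau_Symbols"
begin

text \<open>
  Model of computation: a unit-cost random access machine over the integers. A machine state
  consists of registers, named by fixed numbers, and a memory that is addressed indirectly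
  through the contents of registers. The program text is finite, so it can only refer to
  finitely many registers and fixed constants; it does not depend on the input.
\<close>

type_synonym state = "(nat \<Rightarrow> int) \<times> (int \<Rightarrow> int)"

datatype arith = Add | Sub | Mul | Div

text \<open>\<open>Div\<close> is division rounded down; division by zero yields zero.\<close>

fun arith_val :: "arith \<Rightarrow> int \<Rightarrow> int \<Rightarrow> int" where
  "arith_val Add x y = x + y"
| "arith_val Sub x y = x - y"
| "arith_val Mul x y = x * y"
| "arith_val Div x y = x div y"

datatype prog =
    Skip
  | Const nat int
  | Arith arith nat nat nat
  | Load nat nat
  | Store nat nat
  | Seq prog prog
  | IfLe nat nat prog prog
  | WhileLe nat nat prog

text \<open>
  \<open>exec B c \<sigma> t \<sigma>'\<close>: started in \<open>\<sigma>\<close>, the program \<open>c\<close> terminates in \<open>\<sigma>'\<close> after \<open>t\<close> operations, and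
  every number written on the way has absolute value at most \<open>B\<close> (a larger result blocks the
  execution). Not only arithmetic operations, but also comparisons, data transfers and loading of
  constants are counted. The size bound excludes the well-known artefact of unit-cost machines that
  large amounts of computation can be encoded in few operations on huge numbers.
\<close>

inductive exec :: "int \<Rightarrow> prog \<Rightarrow> state \<Rightarrow> nat \<Rightarrow> state \<Rightarrow> bool" for B :: int where
  Skip: "exec B Skip \<sigma> 0 \<sigma>"
| Const: "\<bar>c\<bar> \<le> B \<Longrightarrow> exec B (Const r c) (R, M) 1 (R(r := c), M)"
| Arith: "v = arith_val f (R p) (R q) \<Longrightarrow> \<bar>v\<bar> \<le> B \<Longrightarrow>
    exec B (Arith f r p q) (R, M) 1 (R(r := v), M)"
| Load: "\<bar>M (R p)\<bar> \<le> B \<Longrightarrow> exec B (Load r p) (R, M) 1 (R(r := M (R p)), M)"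
| Store: "\<bar>R q\<bar> \<le> B \<Longrightarrow> exec B (Store p q) (R, M) 1 (R, M(R p := R q))"
| Seq: "exec B c1 \<sigma> t1 \<sigma>' \<Longrightarrow> exec B c2 \<sigma>' t2 \<sigma>'' \<Longrightarrow> exec B (Seq c1 c2) \<sigma> (t1 + t2) \<sigma>''"
| IfTrue: "fst \<sigma> p \<le> fst \<sigma> q \<Longrightarrow> exec B c1 \<sigma> t \<sigma>' \<Longrightarrow> exec B (IfLe p q c1 c2) \<sigma> (t + 1) \<sigma>'"
| IfFalse: "\<not> fst \<sigma> p \<le> fst \<sigma> q \<Longrightarrow> exec B c2 \<sigma> t \<sigma>' \<Longrightarrow> exec B (IfLe p q c1 c2) \<sigma> (t + 1) \<sigma>'"
| WhileTrue: "fst \<sigma> p \<le> fst \<sigma> q \<Longrightarrow> exec B c \<sigma> t1 \<sigma>' \<Longrightarrow> exec B (WhileLe p q c) \<sigma>' t2 \<sigma>'' \<Longrightarrow>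
    exec B (WhileLe p q c) \<sigma> (t1 + t2 + 1) \<sigma>''"
| WhileFalse: "\<not> fst \<sigma> p \<le> fst \<sigma> q \<Longrightarrow> exec B (WhileLe p q c) \<sigma> 1 \<sigma>"

lemma exec_deterministic:
  "exec B c \<sigma> t \<sigma>' \<Longrightarrow> exec B c \<sigma> u \<tau> \<Longrightarrow> u = t \<and> \<tau> = \<sigma>'"
proof (induction arbitrary: u \<tau> rule: exec.induct)
  case (Seq c1 \<sigma> t1 \<sigma>' c2 t2 \<sigma>'')
  from Seq.prems show ?case
    by cases (metis Seq.IH)
next
  case (IfTrue \<sigma> p q c1 t \<sigma>' c2)
  from IfTrue.prems show ?case
    by cases (use IfTrue.hyps in \<open>auto dest: IfTrue.IH\<close>)
next
  case (IfFalse \<sigma> p q c2 t \<sigma>' c1)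
  from IfFalse.prems show ?case
    by cases (use IfFalse.hyps in \<open>auto dest: IfFalse.IH\<close>)
next
  case (WhileTrue \<sigma> p q c t1 \<sigma>' t2 \<sigma>'')
  from WhileTrue.prems show ?case
    by cases (metis WhileTrue.IH, use WhileTrue.hyps in simp)
next
  case (WhileFalse \<sigma> p q c)
  from WhileFalse.prems show ?case
    by cases (use WhileFalse.hyps in auto)
qed (erule exec.cases; simp)+

text \<open>
  Vectors of length \<open>n\<close> are functions on \<open>{..<n}\<close>. The input holds \<open>n\<close> and \<open>\<beta>\<close> in registers 0 and 1,
  \<open>a\<close> in the memory cells \<open>0, \<dots>, n - 1\<close> and \<open>w\<close> in the cells \<open>n, \<dots>, 2n - 1\<close>.
\<close>

definition input_state :: "nat \<Rightarrow> (nat \<Rightarrow> int) \<Rightarrow> int \<Rightarrow> (nat \<Rightarrow> int) \<Rightarrow> state" where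
  "input_state n a \<beta> w =
    ((\<lambda>r. if r = 0 then int n else if r = 1 then \<beta> else 0),
     (\<lambda>k. if 0 \<le> k \<and> k < int n then a (nat k)
          else if int n \<le> k \<and> k < 2 * int n then w (nat k - n)
          else 0))"

definition result_value :: "state \<Rightarrow> int" where
  "result_value \<sigma> = fst \<sigma> 0"

definition harmonic :: "nat \<Rightarrow> (nat \<Rightarrow> int) \<Rightarrow> bool" where
  "harmonic n a \<longleftrightarrow>
    (\<forall>i<n. \<forall>j<n. a i \<ge> a j \<longrightarrow> real_of_int (a i) / real_of_int (a j) \<in> \<int>)"

definition objective_values :: "nat \<Rightarrow> (nat \<Rightarrow> int) \<Rightarrow> int \<Rightarrow> (nat \<Rightarrow> int) \<Rightarrow> int set" where
  "objective_values n a \<beta> w =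
    {s + (\<Sum>i<n. w i * x i) | s x. s \<ge> 0 \<and> (\<forall>i<n. s + a i * x i \<ge> \<beta>)}"

definition is_minimum :: "int \<Rightarrow> int set \<Rightarrow> bool" where
  "is_minimum m V \<longleftrightarrow> m \<in> V \<and> (\<forall>v\<in>V. m \<le> v)"

text \<open>
  Asymptotics in the two parameters \<open>n \<ge> 1\<close> and \<open>\<beta> \<ge> 1\<close> jointly: an estimate holds up to a constant
  for all but finitely many pairs. Some exception is unavoidable, because
  \<open>n ln n + n ln \<beta> = 0\<close> for \<open>n = \<beta> = 1\<close>.
\<close>

definition params :: "(nat \<times> int) filter" where
  "params = inf cofinite (principal {(n, \<beta>). n \<ge> 1 \<and> \<beta> \<ge> 1})"

end

theory Submission
  imports Defs
begin

text \<open>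
  For fixed \<open>s\<close> the best choice is \<open>x\<^sub>i = \<lceil>(\<beta> - s) / a\<^sub>i\<rceil>\<close>. Put \<open>u = \<beta> - s\<close> and let
  \<open>a\<^sub>p\<close> be the largest capacity with \<open>u \<le> a\<^sub>p \<lfloor>\<beta> / a\<^sub>p\<rfloor> =: v\<close> (and \<open>v = \<beta>\<close> if there is none).
  Raising \<open>u\<close> to \<open>v\<close> leaves \<open>\<lceil>u / a\<^sub>i\<rceil>\<close> unchanged when \<open>a\<^sub>i \<lfloor>\<beta> / a\<^sub>i\<rfloor> < u\<close>; for all other \<open>i\<close>,
  \<open>a\<^sub>i\<close> divides \<open>v\<close> and the rounded quotient grows by at most \<open>(v - u) / a\<^sub>i\<close>. As
  \<open>\<Sum> w\<^sub>i / a\<^sub>i \<le> 1\<close>, the objective does not increase. Hence some \<open>s = \<beta> mod d\<close> with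
  \<open>d \<in> {1, a\<^sub>1, \<dots>, a\<^sub>n}\<close> is optimal. By divisibility there are at most \<open>1 + log\<^sub>2 \<beta>\<close> such \<open>d\<close>,
  each is handled in linear time, and the next larger \<open>d\<close> is found in the same pass, so that no
  sorting is needed.
\<close>

section \<open>Weakest preconditions with running time\<close>

text \<open>As \<open>exec\<close> is deterministic, the run claimed to exist is the only one:
  \<open>Q\<close> holds for the actual time and final state, and termination without violating the
  size bound is part of the claim.\<close>

definition runs :: "int \<Rightarrow> prog \<Rightarrow> state \<Rightarrow> (nat \<Rightarrow> state \<Rightarrow> bool) \<Rightarrow> bool" where
  "runs B c \<sigma> Q \<longleftrightarrow> (\<exists>t \<sigma>'. exec B c \<sigma> t \<sigma>' \<and> Q t \<sigma>')"

lemma runs_mono: "runs B c \<sigma> Q \<Longrightarrow> (\<And>t \<sigma>'. Q t \<sigma>' \<Longrightarrow> Q' t \<sigma>') \<Longrightarrow> runs B c \<sigma> Q'"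
  unfolding runs_def by blast

text \<open>
  As a congruence rule it makes the simplifier execute a program from left to right: the
  postcondition is not touched before the state it is applied to is known.
\<close>

lemma runs_weak_cong: "\<sigma> = \<tau> \<Longrightarrow> runs B c \<sigma> Q = runs B c \<tau> Q"
  by simp

lemma runs_Skip: "runs B Skip \<sigma> Q \<longleftrightarrow> Q 0 \<sigma>"
  unfolding runs_def by (blast intro: exec.Skip elim: exec.cases)

lemma runs_Const: "runs B (Const r c) \<sigma> Q \<longleftrightarrow> \<bar>c\<bar> \<le> B \<and> Q 1 ((fst \<sigma>)(r := c), snd \<sigma>)"
proof (cases \<sigma>)
  case (Pair R M)
  show ?thesis unfolding runs_def Pair
    by (force intro: exec.Const elim: exec.cases)
qed

lemma runs_Arith:
  "runs B (Arith f r p q) \<sigma> Q \<longleftrightarrow>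
    \<bar>arith_val f (fst \<sigma> p) (fst \<sigma> q)\<bar> \<le> B \<and>
    Q 1 ((fst \<sigma>)(r := arith_val f (fst \<sigma> p) (fst \<sigma> q)), snd \<sigma>)"
proof (cases \<sigma>)
  case (Pair R M)
  show ?thesis unfolding runs_def Pair
    by (force intro: exec.Arith elim: exec.cases)
qed

lemma runs_Load:
  "runs B (Load r p) \<sigma> Q \<longleftrightarrow>
    \<bar>snd \<sigma> (fst \<sigma> p)\<bar> \<le> B \<and> Q 1 ((fst \<sigma>)(r := snd \<sigma> (fst \<sigma> p)), snd \<sigma>)"
proof (cases \<sigma>)
  case (Pair R M)
  show ?thesis unfolding runs_def Pair
    by (force intro: exec.Load elim: exec.cases)
qed

lemma runs_Seq:
  "runs B (Seq c1 c2) \<sigma> Q \<longleftrightarrow> runs B c1 \<sigma> (\<lambda>t \<sigma>'. runs B c2 \<sigma>' (\<lambda>u. Q (t + u)))"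
  (is "?L \<longleftrightarrow> ?R")
proof
  assume ?L
  then obtain t \<sigma>' where "exec B (Seq c1 c2) \<sigma> t \<sigma>'" "Q t \<sigma>'"
    unfolding runs_def by blast
  from this(1) show ?R
    by cases (use \<open>Q t \<sigma>'\<close> in \<open>auto simp: runs_def simp del: split_paired_Ex\<close>)
next
  assume ?R
  then show ?L
    unfolding runs_def by (blast intro: exec.Seq)
qed

lemma runs_IfLe:
  "runs B (IfLe p q c1 c2) \<sigma> Q \<longleftrightarrow>
    (if fst \<sigma> p \<le> fst \<sigma> q then runs B c1 \<sigma> (\<lambda>t. Q (t + 1)) else runs B c2 \<sigma> (\<lambda>t. Q (t + 1)))"
  (is "?L \<longleftrightarrow> ?R")
proof
  assume ?L
  then obtain t \<sigma>' where "exec B (IfLe p q c1 c2) \<sigma> t \<sigma>'" "Q t \<sigma>'"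
    unfolding runs_def by blast
  from this(1) show ?R
    by cases (use \<open>Q t \<sigma>'\<close> in \<open>auto simp: runs_def simp del: split_paired_Ex\<close>)
next
  assume ?R
  then show ?L
    unfolding runs_def by (cases "fst \<sigma> p \<le> fst \<sigma> q") (metis exec.IfTrue exec.IfFalse)+
qed

lemmas runs_simps = runs_Skip runs_Const runs_Arith runs_Load runs_Seq runs_IfLe

text \<open>The index \<open>k\<close> of the invariant is a budget of remaining iterations. A
  passed test forces \<open>k\<close> to be a successor, so the loop stops at budget 0 at the
  latest. Each round costs \<open>b\<close> plus one test; the last \<open>+ 1\<close> is the
  failing test.\<close>

lemma runs_WhileLe:
  assumes step: "\<And>k \<sigma>. I k \<sigma> \<Longrightarrow> fst \<sigma> p \<le> fst \<sigma> q \<Longrightarrow>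
      \<exists>k'. k = Suc k' \<and> runs B c \<sigma> (\<lambda>t \<sigma>'. t \<le> b \<and> I k' \<sigma>')"
    and "I k \<sigma>"
  shows "runs B (WhileLe p q c) \<sigma>
    (\<lambda>t \<sigma>'. t \<le> k * (b + 1) + 1 \<and> \<not> fst \<sigma>' p \<le> fst \<sigma>' q \<and> (\<exists>k'. I k' \<sigma>'))"
  using \<open>I k \<sigma>\<close>
proof (induction k arbitrary: \<sigma> rule: less_induct)
  case (less k)
  show ?case
  proof (cases "fst \<sigma> p \<le> fst \<sigma> q")
    case True
    from step[OF less.prems True] obtain k' t \<sigma>' where k: "k = Suc k'"
      and *: "exec B c \<sigma> t \<sigma>'" "t \<le> b" "I k' \<sigma>'"
      unfolding runs_def by blast
    have "k' < k" using k by simp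
    from less.IH[OF this *(3)] obtain u \<sigma>'' where
      **: "exec B (WhileLe p q c) \<sigma>' u \<sigma>''" "u \<le> k' * (b + 1) + 1"
        "\<not> fst \<sigma>'' p \<le> fst \<sigma>'' q" "\<exists>k'. I k' \<sigma>''"
      unfolding runs_def by blast
    have "exec B (WhileLe p q c) \<sigma> (t + u + 1) \<sigma>''"
      using True *(1) **(1) by (rule exec.WhileTrue)
    moreover have "t + u + 1 \<le> k * (b + 1) + 1"
      using k *(2) **(2) by simp
    ultimately show ?thesis
      using ** unfolding runs_def by blast
  next
    case False
    then have "exec B (WhileLe p q c) \<sigma> 1 \<sigma>" by (rule exec.WhileFalse)
    with False less.prems show ?thesis
      unfolding runs_def by (intro exI[of _ 1] exI[of _ \<sigma>]) auto
  qed
qed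

section \<open>Reduction to few values of the continuous variable\<close>

text \<open>For positive \<open>a i\<close>, \<open>- ((s - \<beta>) div a i)\<close> is the ceiling
  of \<open>(\<beta> - s) / a i\<close>, since \<open>div\<close> rounds down. This is the least
  feasible \<open>x i\<close> for the given \<open>s\<close>.\<close>

definition cost :: "nat \<Rightarrow> (nat \<Rightarrow> int) \<Rightarrow> int \<Rightarrow> (nat \<Rightarrow> int) \<Rightarrow> int \<Rightarrow> int" where
  "cost n a \<beta> w s = s + (\<Sum>i<n. w i * - ((s - \<beta>) div a i))"

lemma feasible_iff:
  fixes a :: int
  assumes "a \<ge> 1"
  shows "s + a * x \<ge> \<beta> \<longleftrightarrow> - ((s - \<beta>) div a) \<le> x"
proof -
  have "s + a * x \<ge> \<beta> \<longleftrightarrow> - x * a \<le> s - \<beta>" by (auto simp: algebra_simps)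
  also have "\<dots> \<longleftrightarrow> - x \<le> (s - \<beta>) div a"
  proof -
    have "- x \<le> (s - \<beta>) div a" if "- x * a \<le> s - \<beta>"
      using zdiv_mono1[OF that, of a] assms by (simp del: minus_mult_left mult_minus_left)
    moreover have "- x * a \<le> s - \<beta>" if "- x \<le> (s - \<beta>) div a"
    proof -
      have "- x * a \<le> (s - \<beta>) div a * a"
        using that assms by (intro mult_right_mono) auto
      also have "\<dots> \<le> s - \<beta>"
        using assms pos_mod_sign[of a "s - \<beta>"] div_mult_mod_eq[of "s - \<beta>" a] by linarith
      finally show ?thesis .
    qed
    ultimately show ?thesis by blast
  qed
  finally show ?thesis by linarith
qed

lemma cost_in_objective_values:
  assumes "\<forall>i<n. a i \<ge> 1" "s \<ge> 0"
  shows "cost n a \<beta> w s \<in> objective_values n a \<beta> w"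
proof -
  have "\<forall>i<n. s + a i * - ((s - \<beta>) div a i) \<ge> \<beta>"
    using assms(1) feasible_iff by blast
  with assms(2) show ?thesis
    unfolding objective_values_def cost_def mem_Collect_eq
    by (intro exI[of _ s] exI[of _ "\<lambda>i. - ((s - \<beta>) div a i)"] conjI refl)
qed

text \<open>With nonnegative weights the least feasible \<open>x\<close> is best for each
  \<open>s\<close>, so only the choice of \<open>s\<close> remains.\<close>

lemma objective_value_ge_cost:
  assumes "\<forall>i<n. a i \<ge> 1" "\<forall>i<n. w i \<ge> 0" "v \<in> objective_values n a \<beta> w"
  obtains s where "s \<ge> 0" "cost n a \<beta> w s \<le> v"
proof -
  from assms(3) obtain s x where *: "v = s + (\<Sum>i<n. w i * x i)" "s \<ge> 0"
    "\<forall>i<n. s + a i * x i \<ge> \<beta>"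
    unfolding objective_values_def by blast
  have "cost n a \<beta> w s \<le> v"
    unfolding cost_def *(1)
    by (intro add_left_mono sum_mono mult_left_mono)
      (use assms(1,2) *(3) in \<open>simp_all add: feasible_iff\<close>)
  with *(2) show thesis by (rule that)
qed

text \<open>Lowering \<open>s\<close> to \<open>s'\<close> saves \<open>s - s'\<close>. By
  \<open>incr\<close> the ceilings grow by at most \<open>(s - s') / a i\<close>, and weighting
  these increments by \<open>w i\<close> gives a total of at most \<open>s - s'\<close>.\<close>

lemma cost_le_by_increments:
  assumes "s' \<le> s" "\<forall>i<n. w i \<ge> 0"
    and weight: "(\<Sum>i<n. real_of_int (w i) / real_of_int (a i)) \<le> 1"
    and incr: "\<And>i. i < n \<Longrightarrow>
      real_of_int ((s - \<beta>) div a i - (s' - \<beta>) div a i) \<le> real_of_int (s - s') / real_of_int (a i)"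
  shows "cost n a \<beta> w s' \<le> cost n a \<beta> w s"
proof -
  have "real_of_int (cost n a \<beta> w s' - cost n a \<beta> w s) =
      real_of_int (s' - s) + (\<Sum>i<n. w i * real_of_int ((s - \<beta>) div a i - (s' - \<beta>) div a i))"
    by (simp add: cost_def sum_negf sum_subtractf right_diff_distrib)
  also have "\<dots> \<le> real_of_int (s' - s) + (\<Sum>i<n. w i * (real_of_int (s - s') / real_of_int (a i)))"
    using assms(2) incr by (intro add_left_mono sum_mono mult_left_mono) auto
  also have "\<dots> = real_of_int (s' - s) +
      real_of_int (s - s') * (\<Sum>i<n. real_of_int (w i) / real_of_int (a i))"
    by (simp add: sum_distrib_left mult_ac)
  also have "\<dots> \<le> real_of_int (s' - s) + real_of_int (s - s') * 1"
    using assms(1) weight by (intro add_left_mono mult_left_mono) auto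
  finally show ?thesis by simp
qed

lemma harmonic_dvd:
  assumes "harmonic n a" "i < n" "j < n" "a j \<le> a i" "a j \<ge> 1"
  shows "a j dvd a i"
proof -
  from assms have "real_of_int (a i) / real_of_int (a j) \<in> \<int>"
    unfolding harmonic_def by blast
  then obtain k where "real_of_int (a i) / real_of_int (a j) = of_int k"
    by (auto elim: Ints_cases)
  with assms(5) have "real_of_int (a i) = of_int (a j * k)"
    by (simp add: field_simps)
  then show ?thesis by (simp only: of_int_eq_iff dvd_triv_left)
qed

lemma optimal_residue:
  assumes pos: "\<forall>i<n. a i \<ge> 1" and harm: "harmonic n a" and wpos: "\<forall>i<n. w i \<ge> 0"
    and weight: "(\<Sum>i<n. real_of_int (w i) / real_of_int (a i)) \<le> 1" and "s \<ge> 0"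
  obtains d where "d \<in> insert 1 (a ` {..<n})" "cost n a \<beta> w (\<beta> mod d) \<le> cost n a \<beta> w s"
proof -
  \<comment> \<open>With \<open>u = \<beta> - s\<close>, the condition on \<open>i\<close> says
    \<open>u \<le> a i * (\<beta> div a i)\<close>. The indices outside \<open>J\<close> will keep
    their rounded quotient.\<close>
  define J where "J = {i. i < n \<and> \<beta> mod a i \<le> s}"
  obtain d where d: "d \<in> insert 1 (a ` {..<n})" "\<beta> mod d \<le> s" "\<forall>i\<in>J. a i dvd d"
  proof (cases "J = {}")
    case True
    \<comment> \<open>\<open>\<beta> mod 1 = 0\<close>, so \<open>d = 1\<close> serves when no
      capacity qualifies.\<close>
    then show thesis using that[of 1] \<open>s \<ge> 0\<close> by simp
  next
    case False
    have "finite J" unfolding J_def by simp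
    then have "Max (a ` J) \<in> a ` J" using False by (intro Max_in) auto
    then obtain p where p: "p \<in> J" "a p = Max (a ` J)" by auto
    have p': "p < n" "\<beta> mod a p \<le> s" using p(1) by (simp_all add: J_def)
    have "a i dvd a p" if "i \<in> J" for i
    proof (rule harmonic_dvd[OF harm p'(1)])
      show "a i \<le> a p" unfolding p(2) using \<open>finite J\<close> that by (intro Max_ge) auto
      show "i < n" using that by (simp add: J_def)
      then show "a i \<ge> 1" using pos by blast
    qed
    then show thesis using that[of "a p"] p' by blast
  qed
  define s' where "s' = \<beta> mod d"
  have "d \<ge> 1" using d(1) pos by auto
  then have s': "0 \<le> s'" "s' \<le> s" "d dvd \<beta> - s'"
    using d(2) by (simp_all add: s'_def)
  have "cost n a \<beta> w s' \<le> cost n a \<beta> w s"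
  proof (rule cost_le_by_increments[OF s'(2) wpos weight])
    fix i assume i: "i < n"
    with pos have ai: "a i \<ge> 1" by blast
    show "real_of_int ((s - \<beta>) div a i - (s' - \<beta>) div a i) \<le> real_of_int (s - s') / real_of_int (a i)"
    proof (cases "i \<in> J")
      case True
      \<comment> \<open>Since \<open>a i\<close> divides \<open>d\<close> and \<open>d\<close>
        divides \<open>\<beta> - s'\<close>, the quotient at \<open>s'\<close> is exact; only the
        one at \<open>s\<close> is rounded, and downwards.\<close>
      with d(3) s'(3) have "a i dvd \<beta> - s'" by (blast intro: dvd_trans)
      then have "a i dvd s' - \<beta>" by (simp add: dvd_diff_commute)
      then have "real_of_int ((s' - \<beta>) div a i) = real_of_int (s' - \<beta>) / real_of_int (a i)"
        by (rule real_of_int_div)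
      moreover have "real_of_int ((s - \<beta>) div a i) \<le> real_of_int (s - \<beta>) / real_of_int (a i)"
        by (rule real_of_int_div4)
      ultimately show ?thesis by (simp add: diff_divide_distrib)
    next
      case False
      \<comment> \<open>All such \<open>r\<close> lie below \<open>\<beta> mod a i\<close>; adding
        \<open>a i\<close> to \<open>r - \<beta> mod a i\<close> brings it into the range of
        remainders. Hence \<open>s\<close> and \<open>s'\<close> have the same quotient.\<close>
      have *: "(r - \<beta>) div a i = - (\<beta> div a i) - 1" if "0 \<le> r" "r \<le> s" for r
      proof -
        have "r < \<beta> mod a i" using False i that unfolding J_def by simp
        moreover have "\<beta> mod a i < a i" using ai by simp
        ultimately have "0 \<le> r - \<beta> mod a i + a i" "r - \<beta> mod a i + a i < a i" using that by auto
        then have "(r - \<beta> mod a i + a i) div a i = 0" by (rule div_pos_pos_trivial)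
        moreover have "r - \<beta> = (r - \<beta> mod a i + a i) + (- (\<beta> div a i) - 1) * a i"
          using div_mult_mod_eq[of \<beta> "a i"] by (simp add: algebra_simps)
        moreover have "((r - \<beta> mod a i + a i) + (- (\<beta> div a i) - 1) * a i) div a i =
            (- (\<beta> div a i) - 1) + (r - \<beta> mod a i + a i) div a i"
          using ai by (intro div_mult_self1) auto
        ultimately show ?thesis by (metis add_0_right)
      qed
      have "(s - \<beta>) div a i = (s' - \<beta>) div a i"
        unfolding *[OF \<open>s \<ge> 0\<close> order.refl] *[OF s'(1,2)] ..
      then show ?thesis using s'(2) ai by simp
    qed
  qed
  with d(1) show thesis unfolding s'_def by (rule that)
qed

lemma is_minimumI:
  assumes "\<forall>i<n. a i \<ge> 1" "harmonic n a" "\<forall>i<n. w i \<ge> 0"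
    "(\<Sum>i<n. real_of_int (w i) / real_of_int (a i)) \<le> 1"
    and "m \<in> objective_values n a \<beta> w"
    and "\<And>d. d \<in> insert 1 (a ` {..<n}) \<Longrightarrow> m \<le> cost n a \<beta> w (\<beta> mod d)"
  shows "is_minimum m (objective_values n a \<beta> w)"
  unfolding is_minimum_def
proof (intro conjI ballI assms(5))
  fix v assume "v \<in> objective_values n a \<beta> w"
  with assms(1,3) obtain s where "s \<ge> 0" "cost n a \<beta> w s \<le> v"
    by (rule objective_value_ge_cost)
  moreover from \<open>s \<ge> 0\<close> obtain d where "d \<in> insert 1 (a ` {..<n})"
    "cost n a \<beta> w (\<beta> mod d) \<le> cost n a \<beta> w s"
    by (rule optimal_residue[OF assms(1-4)])
  ultimately show "m \<le> v" using assms(6) by (meson order.trans)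
qed

section \<open>The program\<close>

text \<open>
  Registers: 2 holds the current \<open>d\<close>, 3 the best value so far, 4 the index \<open>i\<close>, 5 the current \<open>s\<close>,
  6 the partial cost, 7 the next larger \<open>d\<close> (\<open>\<beta> + 1\<close> if there is none), 8 holds \<open>a\<^sub>i\<close>, 10 holds
  \<open>s - \<beta>\<close>, 11 and 12 hold the constants 1 and 0, 9 and 13 are auxiliary.
\<close>

definition scan_body :: prog where
  "scan_body =
    Seq (Load 8 4) (Seq (Arith Add 9 4 0) (Seq (Load 9 9) (Seq (Arith Div 13 10 8)
    (Seq (Arith Mul 9 9 13) (Seq (Arith Sub 6 6 9)
    (Seq (IfLe 8 2 Skip (IfLe 7 8 Skip (Arith Add 7 8 12)))
    (Arith Sub 4 4 11)))))))"

text \<open>In the absence of a remainder operation, \<open>\<beta> mod d\<close> is computed as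
  \<open>\<beta> - (\<beta> div d) * d\<close>. Adding register 12 serves as a move. Register 7
  starts with the sentinel \<open>\<beta> + 1\<close>, and the index at \<open>n - 1\<close> because
  the scan runs downwards.\<close>

definition pass_init :: prog where
  "pass_init =
    Seq (Arith Div 5 1 2) (Seq (Arith Mul 5 5 2) (Seq (Arith Sub 5 1 5)
    (Seq (Arith Add 6 5 12) (Seq (Arith Add 7 1 11) (Seq (Arith Sub 10 5 1)
    (Arith Sub 4 0 11))))))"

definition pass_body :: prog where
  "pass_body =
    Seq pass_init (Seq (WhileLe 12 4 scan_body)
    (Seq (IfLe 3 6 Skip (Arith Add 3 6 12)) (Arith Add 2 7 12)))"

text \<open>The best value starts with \<open>\<beta>\<close>, attained by
  \<open>s = \<beta>\<close> and \<open>x = 0\<close>. The loop ends once \<open>d\<close> is the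
  sentinel \<open>\<beta> + 1\<close>. Register 12 is never assigned: its 0 comes from the input
  state.\<close>

definition residue_search :: prog where
  "residue_search =
    Seq (Const 11 1) (Seq (Const 2 1) (Seq (Arith Add 3 1 12)
    (Seq (WhileLe 2 1 pass_body) (Arith Add 0 3 12))))"

section \<open>Size bounds for the numbers that the program writes\<close>

locale harmonic_instance =
  fixes n :: nat and a :: "nat \<Rightarrow> int" and \<beta> :: int and w :: "nat \<Rightarrow> int"
  assumes n_pos: "n \<ge> 1"
    and a_pos: "\<And>i. i < n \<Longrightarrow> a i \<ge> 1"
    and harmonic: "harmonic n a"
    and a_le: "\<And>i. i < n \<Longrightarrow> a i \<le> \<beta>"
    and w_nonneg: "\<And>i. i < n \<Longrightarrow> w i \<ge> 0"
    and weight: "(\<Sum>i<n. real_of_int (w i) / real_of_int (a i)) \<le> 1"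
begin

lemma beta_pos: "\<beta> \<ge> 1"
  using a_pos[of 0] a_le[of 0] n_pos by simp

text \<open>One nonnegative summand is at most the whole sum, so \<open>w i \<le> a i\<close>. Thus
  the weights, too, are bounded in terms of \<open>\<beta>\<close>.\<close>

lemma w_le: "i < n \<Longrightarrow> w i \<le> \<beta>"
proof -
  assume i: "i < n"
  have "real_of_int (w i) / real_of_int (a i) \<le> (\<Sum>i<n. real_of_int (w i) / real_of_int (a i))"
    using i a_pos w_nonneg by (intro member_le_sum) (auto intro!: divide_nonneg_nonneg simp: order.trans[OF zero_le_one])
  also note weight
  finally have "w i \<le> a i" using a_pos[OF i] by (simp add: divide_le_eq_1)
  with a_le[OF i] show ?thesis by simp
qed

abbreviation B :: int where "B \<equiv> (int n + \<beta>) ^ 4"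

text \<open>The three bounds are for partial costs, memory addresses and the sentinel. Partial costs
  are at most \<open>N + N^3\<close> with \<open>N = n + \<beta>\<close>, and
  \<open>N \<ge> 2\<close> absorbs this into \<open>N^4\<close>; hence the exponent 4.\<close>

lemma B_bound: "\<beta> + int n * (\<beta> * \<beta>) \<le> B" "2 * int n \<le> B" "\<beta> + 1 \<le> B"
proof -
  define N where "N = int n + \<beta>"
  have N: "N \<ge> 2" "\<beta> \<le> N" "0 \<le> \<beta>" "int n \<le> N" using n_pos beta_pos by (auto simp: N_def)
  have N2: "2 * N \<le> N * N" using N by (intro mult_right_mono) auto
  have N3: "N * N \<le> N * N * N" using N mult_left_mono[of 1 N "N * N"] by simp
  have N4: "2 * (N * N * N) \<le> N * (N * N * N)" using N by (intro mult_right_mono) auto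
  have B: "B = N * (N * N * N)" by (simp add: N_def numeral_eq_Suc)
  have "int n * (\<beta> * \<beta>) \<le> N * (N * N)" using N by (intro mult_mono) auto
  then have *: "int n * (\<beta> * \<beta>) \<le> N * N * N" by (simp only: mult.assoc)
  show "\<beta> + int n * (\<beta> * \<beta>) \<le> B" unfolding B using * N2 N3 N4 N by linarith
  show "2 * int n \<le> B" "\<beta> + 1 \<le> B" unfolding B using N2 N3 N4 N by linarith+
qed

definition quot :: "int \<Rightarrow> nat \<Rightarrow> int" where
  "quot s i = (s - \<beta>) div a i"

text \<open>The content of register 6 when the downward scan has processed the indices from
  \<open>k\<close> on.\<close>

definition tail_cost :: "int \<Rightarrow> nat \<Rightarrow> int" where
  "tail_cost s k = s - (\<Sum>i=k..<n. w i * quot s i)"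

lemma tail_cost_0: "tail_cost s 0 = cost n a \<beta> w s"
  by (simp add: tail_cost_def cost_def quot_def sum_negf atLeast0LessThan)

lemma tail_cost_n: "tail_cost s n = s"
  by (simp add: tail_cost_def)

lemma tail_cost_Suc: "k < n \<Longrightarrow> tail_cost s k = tail_cost s (Suc k) - w k * quot s k"
  by (simp add: tail_cost_def sum.atLeast_Suc_lessThan)

lemma quot_bounds:
  assumes "0 \<le> s" "s \<le> \<beta>" "i < n"
  shows "- \<beta> \<le> quot s i" "quot s i \<le> 0"
proof -
  have "(- \<beta>) * a i \<le> - \<beta>" using a_pos[OF assms(3)] beta_pos by simp
  then have "- \<beta> * a i \<le> s - \<beta>" using assms(1) by linarith
  then have "(- \<beta> * a i) div a i \<le> (s - \<beta>) div a i"
    using a_pos[OF assms(3)] by (intro zdiv_mono1) auto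
  moreover have "(- \<beta> * a i) div a i = - \<beta>"
    using a_pos[OF assms(3)] by (intro nonzero_mult_div_cancel_right) auto
  ultimately show "- \<beta> \<le> quot s i" by (simp add: quot_def)
  have "(s - \<beta>) div a i \<le> 0 div a i"
    using a_pos[OF assms(3)] assms(2) by (intro zdiv_mono1) auto
  then show "quot s i \<le> 0" by (simp add: quot_def)
qed

lemma abs_w_quot_le:
  assumes "0 \<le> s" "s \<le> \<beta>" "i < n"
  shows "\<bar>w i * quot s i\<bar> \<le> \<beta> * \<beta>"
  unfolding abs_mult using quot_bounds[OF assms] w_le[OF assms(3)] w_nonneg[OF assms(3)]
  by (intro mult_mono) auto

lemma abs_tail_cost_le:
  assumes "0 \<le> s" "s \<le> \<beta>"
  shows "\<bar>tail_cost s k\<bar> \<le> B"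
proof -
  have "\<bar>tail_cost s k\<bar> \<le> s + \<bar>\<Sum>i=k..<n. w i * quot s i\<bar>"
    using assms(1) by (simp add: tail_cost_def)
  also have "\<bar>\<Sum>i=k..<n. w i * quot s i\<bar> \<le> (\<Sum>i=k..<n. \<beta> * \<beta>)"
    using assms by (intro order.trans[OF sum_abs] sum_mono abs_w_quot_le) auto
  also have "\<dots> \<le> int n * (\<beta> * \<beta>)"
    using beta_pos by (simp add: mult_right_mono)
  finally show ?thesis using B_bound(1) assms(2) by linarith
qed

section \<open>The inner loop: one scan of the capacities\<close>

abbreviation mem :: "int \<Rightarrow> int" where
  "mem \<equiv> snd (input_state n a \<beta> w)"

lemma mem_a: "i < n \<Longrightarrow> mem (int i) = a i"
  by (simp add: input_state_def)

lemma mem_w: "i < n \<Longrightarrow> mem (int i + int n) = w i"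
  by (simp add: input_state_def nat_add_distrib)

definition frame :: "int \<Rightarrow> int \<Rightarrow> state \<Rightarrow> bool" where
  "frame d m \<sigma> \<longleftrightarrow> snd \<sigma> = mem \<and> fst \<sigma> 0 = int n \<and> fst \<sigma> 1 = \<beta> \<and> fst \<sigma> 2 = d \<and> fst \<sigma> 3 = m \<and>
    fst \<sigma> 11 = 1 \<and> fst \<sigma> 12 = 0"

text \<open>Here \<open>k\<close> counts the unprocessed indices and is also the loop budget.
  Register 7 is the least capacity above \<open>d\<close> among the processed ones, or the
  sentinel.\<close>

definition scan_inv :: "int \<Rightarrow> int \<Rightarrow> int \<Rightarrow> nat \<Rightarrow> state \<Rightarrow> bool" where
  "scan_inv d m s k \<sigma> \<longleftrightarrow> k \<le> n \<and> frame d m \<sigma> \<and> fst \<sigma> 4 = int k - 1 \<and>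
    fst \<sigma> 10 = s - \<beta> \<and> fst \<sigma> 6 = tail_cost s k \<and>
    d < fst \<sigma> 7 \<and> fst \<sigma> 7 \<in> insert (\<beta> + 1) (a ` {..<n}) \<and>
    (\<forall>i\<in>{k..<n}. d < a i \<longrightarrow> fst \<sigma> 7 \<le> a i)"

text \<open>Six operations update the partial cost, at most three the next divisor, and one lowers
  the index.\<close>

lemma runs_scan_body:
  assumes s: "0 \<le> s" "s \<le> \<beta>" and inv: "scan_inv d m s (Suc k) \<sigma>"
  shows "runs B scan_body \<sigma> (\<lambda>t \<sigma>'. t \<le> 10 \<and> scan_inv d m s k \<sigma>')"
proof -
  obtain R M where \<sigma>: "\<sigma> = (R, M)" by (cases \<sigma>)
  have k: "k < n" using inv by (simp add: scan_inv_def)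
  have R: "M = mem" "R 0 = int n" "R (Suc 0) = \<beta>" "R 2 = d" "R 3 = m" "R 11 = 1" "R 12 = 0"
    "R 4 = int k" "R 10 = s - \<beta>" "R 6 = tail_cost s (Suc k)"
    using inv by (simp_all add: scan_inv_def frame_def \<sigma>)
  have nxt: "d < R 7" "R 7 \<in> insert (\<beta> + 1) (a ` {..<n})" "\<forall>i\<in>{Suc k..<n}. d < a i \<longrightarrow> R 7 \<le> a i"
    using inv by (simp_all add: scan_inv_def \<sigma>)
  \<comment> \<open>The content of register 7 after the nested conditional.\<close>
  define e where "e = (if a k \<le> d then R 7 else if R 7 \<le> a k then R 7 else a k)"
  have e: "d < e" "e \<in> insert (\<beta> + 1) (a ` {..<n})" using nxt(1,2) k by (auto simp: e_def)
  have e_min: "\<forall>i\<in>{k..<n}. d < a i \<longrightarrow> e \<le> a i"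
  proof (intro ballI impI)
    fix i assume i: "i \<in> {k..<n}" "d < a i"
    show "e \<le> a i"
    proof (cases "i = k")
      case False
      then have "R 7 \<le> a i" using nxt(3) i by simp
      then show ?thesis by (simp add: e_def)
    qed (use i in \<open>simp add: e_def\<close>)
  qed
  have bounds: "\<bar>a k\<bar> \<le> B" "\<bar>w k\<bar> \<le> B" "int k + int n \<le> B" "\<bar>quot s k\<bar> \<le> B"
    "\<bar>int k - 1\<bar> \<le> B"
    using a_pos[OF k] a_le[OF k] w_nonneg[OF k] w_le[OF k] quot_bounds[OF s k] k B_bound n_pos
    by linarith+
  have "\<beta> * \<beta> \<le> int n * (\<beta> * \<beta>)" using n_pos beta_pos by (simp add: mult_le_cancel_right1)
  then have bound_prod: "\<bar>w k * quot s k\<bar> \<le> B"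
    using abs_w_quot_le[OF s k] B_bound(1) beta_pos by linarith
  have bound_tail: "\<bar>tail_cost s (Suc k) - w k * quot s k\<bar> \<le> B"
    using abs_tail_cost_le[OF s, of k] tail_cost_Suc[OF k] by simp
  show ?thesis
    unfolding scan_body_def \<sigma>
    using k e e_min unfolding e_def
    by (cases "a k \<le> d"; cases "R 7 \<le> a k")
      (simp_all cong: runs_weak_cong add: runs_simps R mem_a mem_w quot_def[symmetric]
        scan_inv_def frame_def tail_cost_Suc bounds bound_prod bound_tail)
qed

lemma runs_scan:
  assumes s: "0 \<le> s" "s \<le> \<beta>" and inv: "scan_inv d m s n \<sigma>"
  shows "runs B (WhileLe 12 4 scan_body) \<sigma> (\<lambda>t \<sigma>'. t \<le> 11 * n + 1 \<and> scan_inv d m s 0 \<sigma>')"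
proof -
  have step: "\<exists>k'. k = Suc k' \<and> runs B scan_body \<sigma> (\<lambda>t \<sigma>'. t \<le> 10 \<and> scan_inv d m s k' \<sigma>')"
    if "scan_inv d m s k \<sigma>" "fst \<sigma> 12 \<le> fst \<sigma> 4" for k \<sigma>
  proof -
    have "0 < k" using that by (simp add: scan_inv_def frame_def)
    then obtain k' where "k = Suc k'" by (cases k) auto
    with runs_scan_body[OF s] that(1) show ?thesis by auto
  qed
  \<comment> \<open>A failed test means \<open>int k - 1 < 0\<close>, so no index is left.\<close>
  have exit: "k = 0" if "scan_inv d m s k \<sigma>'" "\<not> fst \<sigma>' 12 \<le> fst \<sigma>' 4" for k \<sigma>'
    using that by (auto simp: scan_inv_def frame_def)
  show ?thesis
    by (rule runs_mono[OF runs_WhileLe[of "scan_inv d m s", OF step inv]]) (auto dest: exit)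
qed

section \<open>The outer loop over the candidates for \<open>d\<close>\<close>

definition pass_inv :: "nat \<Rightarrow> state \<Rightarrow> bool" where
  "pass_inv k \<sigma> \<longleftrightarrow> (\<exists>d m. frame d m \<sigma> \<and> 1 \<le> d \<and> d \<le> \<beta> + 1 \<and> \<beta> < d * 2 ^ k \<and>
    (d \<le> \<beta> \<longrightarrow> d \<in> insert 1 (a ` {..<n})) \<and> \<bar>m\<bar> \<le> B \<and> m \<in> objective_values n a \<beta> w \<and>
    (\<forall>e \<in> insert 1 (a ` {..<n}). e < d \<longrightarrow> m \<le> cost n a \<beta> w (\<beta> mod e)))"

text \<open>A proper multiple has quotient at least 2. This pays for the factor \<open>2 ^ k\<close>
  in \<open>pass_inv\<close>, making \<open>k\<close> a bound on the remaining passes.\<close>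

lemma next_divisor_doubles:
  assumes "d \<in> insert 1 (a ` {..<n})" "i < n" "d < a i"
  shows "2 * d \<le> a i"
proof -
  have "d \<ge> 1" using assms(1) a_pos by auto
  have "d dvd a i"
    using assms a_pos by (auto intro!: harmonic_dvd[OF harmonic])
  then obtain q where q: "a i = d * q" by blast
  with assms(3) \<open>d \<ge> 1\<close> have "1 < q" by simp
  then have "d * 2 \<le> d * q" using \<open>d \<ge> 1\<close> by (intro mult_left_mono) auto
  then show ?thesis using q by simp
qed

lemma runs_pass_body:
  assumes inv: "pass_inv k \<sigma>" and cond: "fst \<sigma> 2 \<le> fst \<sigma> 1"
  shows "\<exists>k'. k = Suc k' \<and> runs B pass_body \<sigma> (\<lambda>t \<sigma>'. t \<le> 11 * n + 12 \<and> pass_inv k' \<sigma>')"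
proof -
  obtain R M where \<sigma>: "\<sigma> = (R, M)" by (cases \<sigma>)
  from inv obtain d m where frame: "frame d m \<sigma>" and d: "1 \<le> d" "\<beta> < d * 2 ^ k"
    and d_in: "d \<le> \<beta> \<longrightarrow> d \<in> insert 1 (a ` {..<n})" and m: "\<bar>m\<bar> \<le> B" "m \<in> objective_values n a \<beta> w"
    and opt: "\<forall>e \<in> insert 1 (a ` {..<n}). e < d \<longrightarrow> m \<le> cost n a \<beta> w (\<beta> mod e)"
    unfolding pass_inv_def by blast
  have R: "M = mem" "R 0 = int n" "R (Suc 0) = \<beta>" "R 2 = d" "R 3 = m" "R 11 = 1" "R 12 = 0"
    using frame by (simp_all add: frame_def \<sigma>)
  have d_le: "d \<le> \<beta>" using cond R by (simp add: \<sigma>)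
  with d_in have d_in: "d \<in> insert 1 (a ` {..<n})" by blast
  \<comment> \<open>For \<open>k = 0\<close> the invariant would give \<open>\<beta> < d\<close>,
    against the loop test.\<close>
  have "k \<noteq> 0" using d(2) d_le by (cases k) auto
  then obtain k' where k': "k = Suc k'" by (cases k) auto
  define s where "s = \<beta> mod d"
  have s: "0 \<le> s" "s \<le> \<beta>" using d(1) beta_pos by (auto simp: s_def zmod_le_nonneg_dividend)
  have s_eq: "\<beta> - \<beta> div d * d = s" "- (\<beta> div d * d) = s - \<beta>"
    by (simp_all add: s_def minus_div_mult_eq_mod[symmetric])
  have div_bound: "0 \<le> \<beta> div d" "\<beta> div d \<le> \<beta>"
    using d(1) beta_pos zdiv_mono2[of \<beta> 1 d] by (auto simp: pos_imp_zdiv_nonneg_iff)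
  have mul_bound: "0 \<le> \<beta> div d * d" "\<beta> div d * d \<le> \<beta>"
    using s_eq s div_bound d(1) by auto
  have bounds: "\<bar>\<beta> div d\<bar> \<le> B" "\<bar>\<beta> div d * d\<bar> \<le> B" "\<bar>s\<bar> \<le> B" "\<bar>\<beta> + 1\<bar> \<le> B" "\<bar>s - \<beta>\<bar> \<le> B"
    "\<bar>int n - 1\<bar> \<le> B"
    using div_bound mul_bound s B_bound beta_pos n_pos by linarith+
  have init: "runs B pass_init \<sigma> (\<lambda>t \<sigma>'. t \<le> 7 \<and> scan_inv d m s n \<sigma>')"
    unfolding pass_init_def \<sigma>
    using d_le by (simp cong: runs_weak_cong add: runs_simps bounds R s_eq scan_inv_def frame_def tail_cost_n)
  have final: "runs B (Seq (IfLe 3 6 Skip (Arith Add 3 6 12)) (Arith Add 2 7 12)) \<sigma>'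
      (\<lambda>t \<sigma>''. t \<le> 3 \<and> pass_inv k' \<sigma>'')" if "scan_inv d m s 0 \<sigma>'" for \<sigma>'
  proof -
    obtain R' M' where \<sigma>': "\<sigma>' = (R', M')" by (cases \<sigma>')
    have R': "M' = mem" "R' 0 = int n" "R' (Suc 0) = \<beta>" "R' 2 = d" "R' 3 = m" "R' 11 = 1" "R' 12 = 0"
      "R' 6 = cost n a \<beta> w s"
      using that by (simp_all add: scan_inv_def frame_def \<sigma>' tail_cost_0)
    define e where "e = R' 7"
    have e: "d < e" "e \<in> insert (\<beta> + 1) (a ` {..<n})" "\<forall>i<n. d < a i \<longrightarrow> e \<le> a i"
      using that by (simp_all add: scan_inv_def \<sigma>' e_def)
    have e_le: "e \<le> \<beta> + 1" using e(2) a_le by fastforce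
    \<comment> \<open>The sentinel already exceeds \<open>\<beta>\<close>; a capacity is at least
      \<open>2 * d\<close>, which makes up for the lost factor 2.\<close>
    have e_grow: "\<beta> < e * 2 ^ k'"
    proof (cases "e = \<beta> + 1")
      case True
      have "e * 1 \<le> e * 2 ^ k'" using e(1) d(1) by (intro mult_left_mono) auto
      then show ?thesis using True by simp
    next
      case False
      then have "2 * d \<le> e" using e next_divisor_doubles[OF d_in] by auto
      then have "2 * d * 2 ^ k' \<le> e * 2 ^ k'" by (intro mult_right_mono) auto
      moreover have "2 * d * 2 ^ k' = d * 2 ^ k" using k' by simp
      ultimately show ?thesis using d(2) by linarith
    qed
    have "\<bar>e\<bar> \<le> B" using e(1) d(1) e_le B_bound(3) by linarith
    moreover have "\<bar>cost n a \<beta> w s\<bar> \<le> B" using abs_tail_cost_le[OF s, of 0] tail_cost_0 by simp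
    moreover have "pass_inv k' \<sigma>''" if frame: "frame e (min m (cost n a \<beta> w s)) \<sigma>''" for \<sigma>''
      unfolding pass_inv_def
    proof (rule exI[of _ e], rule exI[of _ "min m (cost n a \<beta> w s)"], intro conjI frame e_le e_grow)
      show "1 \<le> e" using e(1) d(1) by simp
      show "e \<le> \<beta> \<longrightarrow> e \<in> insert 1 (a ` {..<n})" using e(2) by auto
      show "\<bar>min m (cost n a \<beta> w s)\<bar> \<le> B" using m(1) \<open>\<bar>cost n a \<beta> w s\<bar> \<le> B\<close> by (simp add: min_def)
      show "min m (cost n a \<beta> w s) \<in> objective_values n a \<beta> w"
        using m(2) cost_in_objective_values[of n a s] a_pos s(1) by (simp add: min_def)
      show "\<forall>e'\<in>insert 1 (a ` {..<n}). e' < e \<longrightarrow> min m (cost n a \<beta> w s) \<le> cost n a \<beta> w (\<beta> mod e')"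
      proof (intro ballI impI)
        fix e' assume e': "e' \<in> insert 1 (a ` {..<n})" "e' < e"
        \<comment> \<open>\<open>e\<close> is at most every capacity above \<open>d\<close>, so no
          candidate lies strictly between \<open>d\<close> and \<open>e\<close>.\<close>
        then have "e' \<le> d" using e(3) d(1) by fastforce
        then show "min m (cost n a \<beta> w s) \<le> cost n a \<beta> w (\<beta> mod e')"
          using opt e'(1) unfolding s_def by (cases "e' = d") (auto simp: min.coboundedI1)
      qed
    qed
    ultimately show ?thesis
      unfolding \<sigma>' by (auto cong: runs_weak_cong simp: runs_simps R' e_def[symmetric] frame_def min_def)
  qed
  have "runs B pass_body \<sigma> (\<lambda>t \<sigma>'. t \<le> 11 * n + 12 \<and> pass_inv k' \<sigma>')"
    \<comment> \<open>Only the two outer compositions are opened, so that the rest still matches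
      \<open>final\<close>. The times are at most 7, \<open>11 * n + 1\<close> and 3.\<close>
    unfolding pass_body_def runs_Seq[of _ pass_init] runs_Seq[of _ "WhileLe _ _ _"]
  proof (rule runs_mono[OF init], elim conjE)
    fix t :: nat and \<sigma>1 assume t: "t \<le> 7" "scan_inv d m s n \<sigma>1"
    show "runs B (WhileLe 12 4 scan_body) \<sigma>1 (\<lambda>u \<sigma>2.
        runs B (Seq (IfLe 3 6 Skip (Arith Add 3 6 12)) (Arith Add 2 7 12)) \<sigma>2
          (\<lambda>v \<sigma>3. t + (u + v) \<le> 11 * n + 12 \<and> pass_inv k' \<sigma>3))"
    proof (rule runs_mono[OF runs_scan[OF s t(2)]], elim conjE)
      fix u :: nat and \<sigma>2 assume u: "u \<le> 11 * n + 1" "scan_inv d m s 0 \<sigma>2"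
      show "runs B (Seq (IfLe 3 6 Skip (Arith Add 3 6 12)) (Arith Add 2 7 12)) \<sigma>2
          (\<lambda>v \<sigma>3. t + (u + v) \<le> 11 * n + 12 \<and> pass_inv k' \<sigma>3)"
        by (rule runs_mono[OF final[OF u(2)]]) (use t u in auto)
    qed
  qed
  with k' show ?thesis by blast
qed

text \<open>The hypothesis is the budget condition of \<open>pass_inv\<close> for
  \<open>d = 1\<close>. Besides the \<open>k\<close> passes with their tests there are three initial
  operations, the failing test and the final move, hence the 5.\<close>

lemma runs_residue_search:
  assumes "\<beta> < 2 ^ k"
  shows "runs B residue_search (input_state n a \<beta> w) (\<lambda>t \<sigma>.
    t \<le> k * (11 * n + 13) + 5 \<and> is_minimum (result_value \<sigma>) (objective_values n a \<beta> w))"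
proof -
  have beta_feasible: "\<beta> \<in> objective_values n a \<beta> w"
    unfolding objective_values_def mem_Collect_eq
    by (rule exI[of _ \<beta>], rule exI[of _ "\<lambda>_. 0"]) (use beta_pos in simp)
  have "B \<ge> 1" "\<bar>\<beta>\<bar> \<le> B" using B_bound beta_pos by linarith+
  obtain R where input: "input_state n a \<beta> w = (R, mem)"
    and R: "R 0 = int n" "R (Suc 0) = \<beta>" "R 12 = 0"
    by (simp add: input_state_def)
  define \<sigma> where "\<sigma> = (R(11 := 1, 2 := 1, 3 := \<beta>), mem)"
  have inv: "pass_inv k \<sigma>"
    unfolding pass_inv_def
  proof (rule exI[of _ 1], rule exI[of _ \<beta>], intro conjI beta_feasible \<open>\<bar>\<beta>\<bar> \<le> B\<close>)
    show "frame 1 \<beta> \<sigma>" by (simp add: \<sigma>_def frame_def R)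
    show "\<forall>e\<in>insert 1 (a ` {..<n}). e < 1 \<longrightarrow> \<beta> \<le> cost n a \<beta> w (\<beta> mod e)"
      using a_pos by fastforce
  qed (use assms beta_pos in simp_all)
  have loop: "runs B (WhileLe 2 1 pass_body) \<sigma> (\<lambda>t \<sigma>'. t \<le> k * (11 * n + 12 + 1) + 1 \<and>
      \<not> fst \<sigma>' 2 \<le> fst \<sigma>' 1 \<and> (\<exists>k'. pass_inv k' \<sigma>'))"
    by (rule runs_WhileLe[of pass_inv, OF runs_pass_body inv])
  have final: "\<bar>fst \<sigma>' 3 + fst \<sigma>' 12\<bar> \<le> B \<and>
      is_minimum (fst \<sigma>' 3 + fst \<sigma>' 12) (objective_values n a \<beta> w)"
    if "pass_inv k' \<sigma>'" "\<not> fst \<sigma>' 2 \<le> fst \<sigma>' 1" for k' \<sigma>'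
  proof -
    from that(1) obtain d m where "frame d m \<sigma>'" and m: "\<bar>m\<bar> \<le> B" "m \<in> objective_values n a \<beta> w"
      "\<forall>e \<in> insert 1 (a ` {..<n}). e < d \<longrightarrow> m \<le> cost n a \<beta> w (\<beta> mod e)"
      unfolding pass_inv_def by blast
    then have reg: "fst \<sigma>' 3 = m" "fst \<sigma>' 12 = 0" and "\<beta> < d"
      using that(2) by (auto simp: frame_def)
    \<comment> \<open>On exit \<open>d\<close> exceeds \<open>\<beta>\<close> and thus every
      candidate, so all have been compared with \<open>m\<close>.\<close>
    then have "e < d" if "e \<in> insert 1 (a ` {..<n})" for e
      using that a_le beta_pos by fastforce
    with m(3) have "m \<le> cost n a \<beta> w (\<beta> mod e)" if "e \<in> insert 1 (a ` {..<n})" for e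
      using that by blast
    with _ harmonic _ weight m(2) have "is_minimum m (objective_values n a \<beta> w)"
      by (rule is_minimumI) (simp_all add: a_pos w_nonneg)
    with m(1) reg show ?thesis by simp
  qed
  have "runs B (WhileLe 2 1 pass_body) \<sigma> (\<lambda>u \<sigma>'. runs B (Arith Add 0 3 12) \<sigma>' (\<lambda>v \<sigma>''.
      1 + (1 + (1 + (u + v))) \<le> k * (11 * n + 13) + 5 \<and>
      is_minimum (result_value \<sigma>'') (objective_values n a \<beta> w)))"
  proof (rule runs_mono[OF loop], elim conjE exE)
    fix u :: nat and \<sigma>' k'
    assume "u \<le> k * (11 * n + 12 + 1) + 1" and exit: "\<not> fst \<sigma>' 2 \<le> fst \<sigma>' 1" "pass_inv k' \<sigma>'"
    then have "u \<le> k * (11 * n + 13) + 1" by (simp only: add.assoc) simp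
    with final[OF exit(2,1)] show "runs B (Arith Add 0 3 12) \<sigma>' (\<lambda>v \<sigma>''.
        1 + (1 + (1 + (u + v))) \<le> k * (11 * n + 13) + 5 \<and>
        is_minimum (result_value \<sigma>'') (objective_values n a \<beta> w))"
      by (simp add: runs_Arith result_value_def)
  qed
  then show ?thesis
    unfolding residue_search_def using \<open>B \<ge> 1\<close> \<open>\<bar>\<beta>\<bar> \<le> B\<close>
    by (subst input) (simp cong: runs_weak_cong add: runs_simps R \<sigma>_def)
qed

end

section \<open>Asymptotics\<close>

lemma eventually_params:
  assumes "\<And>n \<beta>. n \<ge> 1 \<Longrightarrow> \<beta> \<ge> 1 \<Longrightarrow> (n, \<beta>) \<noteq> (1, 1) \<Longrightarrow> P (n, \<beta>)"
  shows "eventually P params"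
proof -
  have "finite {x. \<not> (x \<in> {(n, \<beta>). n \<ge> 1 \<and> \<beta> \<ge> 1} \<longrightarrow> P x)}"
    by (rule finite_subset[of _ "{(1, 1)}"]) (use assms in auto)
  then show ?thesis
    unfolding params_def eventually_inf_principal eventually_cofinite .
qed

text \<open>The 29 is \<open>11 + 13 + 5\<close>: for \<open>n, k \<ge> 1\<close> all terms of the
  step count are absorbed into \<open>k * n\<close>.\<close>

definition search_time :: "nat \<times> int \<Rightarrow> real" where
  "search_time = (\<lambda>(n, \<beta>). 29 * real n * (1 + log 2 (real_of_int \<beta>)))"

lemma search_time_bigo:
  "search_time \<in> O[params](\<lambda>(n, \<beta>). real n * ln (real n) + real n * ln (real_of_int \<beta>))"
proof (rule bigoI[where c = "58 / ln 2"], rule eventually_params)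
  fix n :: nat and \<beta> :: int
  assume *: "n \<ge> 1" "\<beta> \<ge> 1" "(n, \<beta>) \<noteq> (1, 1)"
  have nonneg: "0 \<le> ln (real n)" "0 \<le> ln (real_of_int \<beta>)" using * by auto
  \<comment> \<open>Away from \<open>(1, 1)\<close> one parameter is at least 2, so the logarithms
    absorb the constant term of \<open>search_time\<close>; this doubles 29 to 58.\<close>
  have "ln 2 \<le> ln (real n) + ln (real_of_int \<beta>)"
  proof (cases "n = 1")
    case True
    then have "ln 2 \<le> ln (real_of_int \<beta>)" using * by (subst ln_le_cancel_iff) auto
    then show ?thesis using nonneg by linarith
  next
    case False
    then have "ln 2 \<le> ln (real n)" using * by (subst ln_le_cancel_iff) auto
    then show ?thesis using nonneg by linarith
  qed
  moreover have "x + z \<le> 2 * (y + z)" if "x \<le> y + z" "0 \<le> y" for x y z :: real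
    using that by simp
  ultimately have "ln 2 + ln (real_of_int \<beta>) \<le> 2 * (ln (real n) + ln (real_of_int \<beta>))"
    using nonneg by blast
  then have "29 / ln 2 * real n * (ln 2 + ln (real_of_int \<beta>)) \<le>
      29 / ln 2 * real n * (2 * (ln (real n) + ln (real_of_int \<beta>)))"
    by (intro mult_left_mono) auto
  also have "29 / ln 2 * real n * (ln 2 + ln (real_of_int \<beta>)) = search_time (n, \<beta>)"
    by (simp add: search_time_def log_def field_simps)
  also have "29 / ln 2 * real n * (2 * (ln (real n) + ln (real_of_int \<beta>))) =
      58 / ln 2 * (real n * ln (real n) + real n * ln (real_of_int \<beta>))"
    by (simp add: field_simps)
  finally have "search_time (n, \<beta>) \<le> 58 / ln 2 * (real n * ln (real n) + real n * ln (real_of_int \<beta>))" .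
  moreover have "0 \<le> search_time (n, \<beta>)" using * by (simp add: search_time_def)
  moreover have "0 \<le> real n * ln (real n) + real n * ln (real_of_int \<beta>)" using nonneg by simp
  ultimately show "norm (search_time (n, \<beta>)) \<le> 58 / ln 2 *
      norm (case (n, \<beta>) of (n, \<beta>) \<Rightarrow> real n * ln (real n) + real n * ln (real_of_int \<beta>))"
    by simp
qed

text \<open>Each of the two logarithms is at most \<open>ln (n + \<beta>)\<close>, hence the
  constant 2.\<close>

lemma sum_of_logs_bigo:
  "(\<lambda>(n, \<beta>). real n * ln (real n) + real n * ln (real_of_int \<beta>))
    \<in> O[params](\<lambda>(n, \<beta>). real n * ln (real n + real_of_int \<beta>))"
proof (rule bigoI[where c = 2], rule eventually_params)
  fix n :: nat and \<beta> :: int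
  assume *: "n \<ge> 1" "\<beta> \<ge> 1"
  have "real n * ln (real n) \<le> real n * ln (real n + real_of_int \<beta>)"
    "real n * ln (real_of_int \<beta>) \<le> real n * ln (real n + real_of_int \<beta>)"
    using * by (auto intro!: mult_left_mono)
  moreover have "0 \<le> real n * ln (real n)" "0 \<le> real n * ln (real_of_int \<beta>)" using * by auto
  ultimately show "norm (case (n, \<beta>) of (n, \<beta>) \<Rightarrow> real n * ln (real n) + real n * ln (real_of_int \<beta>))
      \<le> 2 * norm (case (n, \<beta>) of (n, \<beta>) \<Rightarrow> real n * ln (real n + real_of_int \<beta>))"
    by simp
qed

text \<open>The witness is the binary length of \<open>\<beta>\<close>.\<close>

lemma ex_doubling_steps:
  assumes "(\<beta>::int) \<ge> 1"
  obtains k where "\<beta> < 2 ^ k" "k \<ge> 1" "real k \<le> 1 + log 2 (real_of_int \<beta>)"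
proof -
  define k where "k = nat \<lfloor>log 2 (real_of_int \<beta>)\<rfloor> + 1"
  have "0 \<le> log 2 (real_of_int \<beta>)" using assms by simp
  then have k: "real k = real_of_int \<lfloor>log 2 (real_of_int \<beta>)\<rfloor> + 1" by (simp add: k_def)
  have "log 2 (real_of_int \<beta>) < real k" unfolding k by linarith
  then have "real_of_int \<beta> < 2 powr real k" using assms by (simp add: log_less_iff)
  then have "real_of_int \<beta> < real_of_int (2 ^ k)" by (simp add: powr_realpow)
  then have "\<beta> < 2 ^ k" by (simp only: of_int_less_iff)
  moreover have "real k \<le> 1 + log 2 (real_of_int \<beta>)" unfolding k by linarith
  ultimately show thesis using that[of k] by (simp add: k_def)
qed

text \<open>Program, time bound and exponent are chosen before the instance, so one program serves
  all inputs. The inclusion of O-classes expresses the comparison of the two bounds.\<close>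

theorem theorem25:
  "(\<exists>(c::prog) (T :: nat \<times> int \<Rightarrow> real) (K::nat).
      (\<forall>(n::nat) (a :: nat \<Rightarrow> int) (\<beta>::int) (w :: nat \<Rightarrow> int).
         n \<ge> 1 \<longrightarrow>
         (\<forall>i<n. a i \<ge> 1) \<longrightarrow>
         harmonic n a \<longrightarrow>
         \<beta> \<ge> Max (a ` {..<n}) \<longrightarrow>
         (\<forall>i<n. w i \<ge> 0) \<longrightarrow>
         (\<Sum>i<n. real_of_int (w i) / real_of_int (a i)) \<le> 1 \<longrightarrow>
         (\<exists>t \<sigma>. exec ((int n + \<beta>) ^ K) c (input_state n a \<beta> w) t \<sigma> \<and>
                is_minimum (result_value \<sigma>) (objective_values n a \<beta> w) \<and>
                real t \<le> T (n, \<beta>))) \<and>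
      T \<in> O[params](\<lambda>(n, \<beta>). real n * ln (real n) + real n * ln (real_of_int \<beta>))) \<and>
   O[params](\<lambda>(n, \<beta>). real n * ln (real n) + real n * ln (real_of_int \<beta>))
     \<subseteq> O[params](\<lambda>(n, \<beta>). real n * ln (real n + real_of_int \<beta>))"
proof (rule conjI, rule exI[of _ residue_search], rule exI[of _ search_time], rule exI[of _ 4],
    rule conjI[OF _ search_time_bigo], intro allI impI)
  fix n :: nat and a :: "nat \<Rightarrow> int" and \<beta> :: int and w :: "nat \<Rightarrow> int"
  assume *: "n \<ge> 1" "\<forall>i<n. a i \<ge> 1" "harmonic n a" "\<beta> \<ge> Max (a ` {..<n})" "\<forall>i<n. w i \<ge> 0"
    "(\<Sum>i<n. real_of_int (w i) / real_of_int (a i)) \<le> 1"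
  have "a i \<le> \<beta>" if "i < n" for i
    using that by (intro order.trans[OF Max_ge *(4)]) auto
  with * interpret harmonic_instance n a \<beta> w by unfold_locales auto
  obtain k where k: "\<beta> < 2 ^ k" "k \<ge> 1" "real k \<le> 1 + log 2 (real_of_int \<beta>)"
    using ex_doubling_steps beta_pos by blast
  have time: "real t \<le> search_time (n, \<beta>)" if "t \<le> k * (11 * n + 13) + 5" for t
  proof -
    have "k * (11 * n + 13) + 5 = 11 * (k * n) + 13 * k + 5" by (simp add: algebra_simps)
    also have "\<dots> \<le> 11 * (k * n) + 13 * (k * n) + 5 * (k * n)"
      using n_pos k(2) by (intro add_mono) auto
    also have "\<dots> = 29 * n * k" by simp
    finally have "k * (11 * n + 13) + 5 \<le> 29 * n * k" .
    with that have "real t \<le> real (29 * n * k)" by linarith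
    also have "\<dots> \<le> search_time (n, \<beta>)"
      using mult_left_mono[OF k(3), of "29 * real n"] by (simp add: search_time_def)
    finally show ?thesis .
  qed
  show "\<exists>t \<sigma>. exec ((int n + \<beta>) ^ 4) residue_search (input_state n a \<beta> w) t \<sigma> \<and>
      is_minimum (result_value \<sigma>) (objective_values n a \<beta> w) \<and> real t \<le> search_time (n, \<beta>)"
    using runs_residue_search[OF k(1)] unfolding runs_def by (blast intro: time)
next
  show "O[params](\<lambda>(n, \<beta>). real n * ln (real n) + real n * ln (real_of_int \<beta>))
      \<subseteq> O[params](\<lambda>(n, \<beta>). real n * ln (real n + real_of_int \<beta>))"
    by (rule subsetI, rule landau_o.big_trans[OF _ sum_of_logs_bigo])
qed

end
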